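(* Let $m\ge2$, $\mathcal{A}\in\mathtt{T}^m(\mathbb{R}^n)$ and $\delta>0$. Let $H(\mathbb{R},\mathcal{A})$ be the (finite) set of real $\mathtt{H}$-eigenvalues of $\mathcal{A}$. Suppose $\mu_i\in H(\mathbb{R},\mathcal{A})$ and let $\mu_{\max}$ be the maximum element of $H(\mathbb{R},\mathcal{A})$. Put $$\upsilon_i:=\max\{\mu\in H(\mathbb{R},\mathcal{A}):\mu\le\mu_i+\delta\},\qquad \varpi(\mu_i+\delta):=\min\{\mu\in H(\mathbb{R},\mathcal{A}):\mu\ge\mu_i+\delta\}$$ (the latter when the set is nonempty). (i) If $\upsilon_i=\mu_i$ and $\mu_{\max}>\mu_i$, then $\varpi(\mu_i+\delta)=\mu_{i+1}$, where $\mu_{i+1}$ is the smallest real $\mathtt{H}$-eigenvalue of $\mathcal{A}$ bigger than $\mu_i$. (ii) If $\upsilon_i=\mu_i$ and the semidefinite relaxation $(P_k)$ defined in the context is infeasible for some $k\ge k_0$, then $\mu_i=\mu_{\max}$.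
   Context: $\mathtt{T}^m(\mathbb{R}^n)$ is the space of real $m$-order $n$-dimensional tensors $\mathcal{A}=(\mathcal{A}_{i_1\cdots i_m})_{1\le i_1,\ldots,i_m\le n}$ (no symmetry assumed). For $x=(x_1,\ldots,x_n)$, $$\mathcal{A}x^{m-1}:=\Big(\sum_{i_2,\ldots,i_m}\mathcal{A}_{j i_2\cdots i_m}x_{i_2}\cdots x_{i_m}\Big)_{j=1,\ldots,n}\ (\text{a vector}),$$ and $x^{[p]}$ denotes the vector with entries $(x_i)^{p}$ (so $x^{[0]}$ is the all-ones vector). A real $\mathtt{H}$-eigenpair is $(\lambda,u)\in\mathbb{R}\times\mathbb{R}^n$ with $u\ne0$ and $\mathcal{A}u^{m-1}=\lambda u^{[m-1]}$; $\lambda$ is then called a real $\mathtt{H}$-eigenvalue (both $\lambda$ and $u$ are required to be real). Notation for $(P_k)$. $\mathbb{N}_d^n:=\{\alpha\in\mathbb{N}^n:|\alpha|\le d\}$, and $\mathbb{R}^{\mathbb{N}_d^n}$ is the space of real vectors $z=(z_\alpha)$ indexed by $\alpha\in\mathbb{N}_d^n$. For a real polynomial $p=\sum_\alpha p_\alpha x^\alpha$ of degree $\le d$ and $z\in \mathbb{R}^{\mathbb{N}_d^n}$, $\langle p,z\rangle:=\sum_\alpha p_\alpha z_\alpha$. For a real polynomial $q$ with $\deg q\le 2k$ and $z\in\mathbb{R}^{\mathbb{N}_{2k}^n}$, the localizing matrix $L_q^{(k)}(z)$ is the symmetric matrix with $\langle qp^2,z\rangle=\mathrm{vec}(p)^TL_q^{(k)}(z)\,\mathrm{vec}(p)$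 for all polynomials $p$ with $\deg(qp^2)\le 2k$, where $\mathrm{vec}(p)$ is the coefficient vector of $p$. For a tuple $h$, $L_h^{(k)}(z)=0$ means $L_{h_j}^{(k)}(z)=0$ for every $j$. $M_k(z):=L_1^{(k)}(z)=(z_{\alpha+\beta})_{\alpha,\beta\in\mathbb{N}_k^n}$. $X\succeq0$ means positive semidefinite. Let $m_0:=2\lceil (m-1)/2\rceil$ (the biggest even number not bigger than $m$), $f(x):=(x^{[m_0-m+1]})^T\mathcal{A}x^{m-1}$, $$h:=\Big(\mathcal{A}x^{m-1}-\big((x^{[m_0-m+1]})^T\mathcal{A}x^{m-1}\big)x^{[m-1]},\ \sum_{j=1}^n (x_j)^{m_0}-1\Big)$$ (a tuple of $n+1$ polynomials), $k_0:=\lceil (m_0+m-1)/2\rceil$. For integers $k\ge k_0$: $$(P_k)\quad \min\ \langle f,z\rangle\ \text{ s.t. }\ \langle 1,z\rangle=1,\ L_h^{(k)}(z)=0,\ M_k(z)\succeq0,\ L^{(k)}_{f-\mu_i-\delta}(z)\succeq0,\ z\in\mathbb{R}^{\mathbb{N}_{2k}^n}.$$ *)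

theory Defs
  imports "HOL-Analysis.Analysis" "HOL-Library.Poly_Mapping"
begin

text \<open>
  The dimension is the cardinality of the finite index type \<open>'n\<close>.  An \<open>m\<close>-order tensor is a function
  on index lists \<open>[i1, \<dots>, im]\<close>; only its values at lists of length \<open>m\<close> are ever used.
  Real polynomials in the variables \<open>x i\<close>, \<open>i :: 'n\<close>, are finitely supported maps from exponents
  to coefficients, with the convolution product of \<^theory>\<open>HOL-Library.Poly_Mapping\<close>.
\<close>

abbreviation lookup where "lookup \<equiv> Poly_Mapping.lookup"
abbreviation keys where "keys \<equiv> Poly_Mapping.keys"

type_synonym ('n, 'r) tensor = "'n list \<Rightarrow> 'r"
type_synonym 'n expo = "'n \<Rightarrow>\<^sub>0 nat"
type_synonym 'n rpoly = "'n expo \<Rightarrow>\<^sub>0 real"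

subsection \<open>Tensors and H-eigenvalues\<close>

text \<open>
  The vector \<open>A x\<^sup>m\<^sup>-\<^sup>1\<close>.  The coefficient ring is left open, so that the same definition
  serves both for real vectors and for the polynomials obtained from the vector of variables.
\<close>

definition tensor_apply :: "nat \<Rightarrow> ('n::finite, 'r::comm_ring_1) tensor \<Rightarrow> ('n \<Rightarrow> 'r) \<Rightarrow> 'n \<Rightarrow> 'r" where
  "tensor_apply m A x j = (\<Sum>is | length is = m - 1. A (j # is) * (\<Prod>i\<leftarrow>is. x i))"

definition H_eigenpair :: "nat \<Rightarrow> ('n::finite, real) tensor \<Rightarrow> real \<Rightarrow> real ^ 'n \<Rightarrow> bool" where
  "H_eigenpair m A l u \<longleftrightarrow>
     u \<noteq> 0 \<and> (\<chi> j. tensor_apply m A (($) u) j) = l *\<^sub>R (\<chi> j. (u $ j) ^ (m - 1))"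

definition H_eigenvalues :: "nat \<Rightarrow> ('n::finite, real) tensor \<Rightarrow> real set" where
  "H_eigenvalues m A = {l. \<exists>u. H_eigenpair m A l u}"

text \<open>
  The set of real H-eigenvalues is finite, as every real H-eigenvalue is an eigenvalue of one fixed
  square matrix acting on the monomials of degree \<open>n(m - 2) + 1\<close>.  Hence \<^const>\<open>Max\<close> and
  \<^const>\<open>Min\<close> below have their usual meaning whenever the set they are applied to is nonempty.
\<close>

definition mu_max :: "nat \<Rightarrow> ('n::finite, real) tensor \<Rightarrow> real" where
  "mu_max m A = Max (H_eigenvalues m A)"

definition mu_next :: "nat \<Rightarrow> ('n::finite, real) tensor \<Rightarrow> real \<Rightarrow> real" where
  "mu_next m A \<mu> = Min {\<nu> \<in> H_eigenvalues m A. \<nu> > \<mu>}"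

definition upsilon :: "nat \<Rightarrow> ('n::finite, real) tensor \<Rightarrow> real \<Rightarrow> real \<Rightarrow> real" where
  "upsilon m A \<delta> \<mu> = Max {\<nu> \<in> H_eigenvalues m A. \<nu> \<le> \<mu> + \<delta>}"

definition varpi :: "nat \<Rightarrow> ('n::finite, real) tensor \<Rightarrow> real \<Rightarrow> real" where
  "varpi m A c = Min {\<nu> \<in> H_eigenvalues m A. \<nu> \<ge> c}"

subsection \<open>Polynomials and truncated moment vectors\<close>

definition expo_deg :: "'n::finite expo \<Rightarrow> nat" where
  "expo_deg a = (\<Sum>i\<in>UNIV. lookup a i)"

definition expos_upto :: "nat \<Rightarrow> 'n::finite expo set" where
  "expos_upto d = {a. expo_deg a \<le> d}"

text \<open>The total degree; the zero polynomial gets degree \<open>0\<close>.\<close>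

definition rpoly_deg :: "'n::finite rpoly \<Rightarrow> nat" where
  "rpoly_deg p = Max (insert 0 (expo_deg ` keys p))"

definition pConst :: "real \<Rightarrow> 'n::finite rpoly" where
  "pConst c = Poly_Mapping.single 0 c"

definition pVar :: "'n::finite \<Rightarrow> 'n rpoly" where
  "pVar i = Poly_Mapping.single (Poly_Mapping.single i 1) 1"

definition pairing :: "'n::finite rpoly \<Rightarrow> ('n expo \<Rightarrow> real) \<Rightarrow> real" where
  "pairing p z = (\<Sum>a\<in>keys p. lookup p a * z a)"

subsection \<open>Localizing matrices\<close>

text \<open>
  For \<open>q \<noteq> 0\<close> the polynomials \<open>p\<close> with \<open>deg (q p\<^sup>2) \<le> 2k\<close> are those whose exponents lie in
  the following set, which therefore indexes the rows and columns of the localizing matrix.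
  (For \<open>q = 0\<close> the localizing matrix is zero whatever the index set.)
\<close>

definition loc_index :: "nat \<Rightarrow> 'n::finite rpoly \<Rightarrow> 'n expo set" where
  "loc_index k q = expos_upto ((2 * k - rpoly_deg q) div 2)"

text \<open>
  Matrices indexed by \<open>loc_index k q\<close> are functions of two exponents that vanish outside this
  index set; the coefficient vector of \<open>p\<close> is \<open>lookup p\<close>.
\<close>

definition is_localizing_matrix ::
    "nat \<Rightarrow> 'n::finite rpoly \<Rightarrow> ('n expo \<Rightarrow> real) \<Rightarrow> ('n expo \<Rightarrow> 'n expo \<Rightarrow> real) \<Rightarrow> bool" where
  "is_localizing_matrix k q z L \<longleftrightarrow>
     (\<forall>a b. a \<notin> loc_index k q \<or> b \<notin> loc_index k q \<longrightarrow> L a b = 0) \<and>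
     (\<forall>a b. L a b = L b a) \<and>
     (\<forall>p. rpoly_deg (q * p ^ 2) \<le> 2 * k \<longrightarrow>
        pairing (q * p ^ 2) z =
          (\<Sum>a\<in>loc_index k q. \<Sum>b\<in>loc_index k q. lookup p a * L a b * lookup p b))"

text \<open>Existence, uniqueness and the explicit entries are shown at the end of this theory.\<close>

definition localizing_matrix ::
    "nat \<Rightarrow> 'n::finite rpoly \<Rightarrow> ('n expo \<Rightarrow> real) \<Rightarrow> 'n expo \<Rightarrow> 'n expo \<Rightarrow> real" where
  "localizing_matrix k q z = (THE L. is_localizing_matrix k q z L)"

definition psd_on :: "'a set \<Rightarrow> ('a \<Rightarrow> 'a \<Rightarrow> real) \<Rightarrow> bool" where
  "psd_on I X \<longleftrightarrow> (\<forall>a\<in>I. \<forall>b\<in>I. X a b = X b a) \<and>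
     (\<forall>v. 0 \<le> (\<Sum>a\<in>I. \<Sum>b\<in>I. v a * X a b * v b))"

definition loc_psd :: "nat \<Rightarrow> 'n::finite rpoly \<Rightarrow> ('n expo \<Rightarrow> real) \<Rightarrow> bool" where
  "loc_psd k q z \<longleftrightarrow> psd_on (loc_index k q) (localizing_matrix k q z)"

definition loc_zero :: "nat \<Rightarrow> 'n::finite rpoly \<Rightarrow> ('n expo \<Rightarrow> real) \<Rightarrow> bool" where
  "loc_zero k q z \<longleftrightarrow> (\<forall>a\<in>loc_index k q. \<forall>b\<in>loc_index k q. localizing_matrix k q z a b = 0)"

subsection \<open>The semidefinite relaxation\<close>

definition m0 :: "nat \<Rightarrow> nat" where
  "m0 m = 2 * nat \<lceil>(real m - 1) / 2\<rceil>"

definition k0 :: "nat \<Rightarrow> nat" where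
  "k0 m = nat \<lceil>(real (m0 m) + real m - 1) / 2\<rceil>"

definition A_poly :: "nat \<Rightarrow> ('n::finite, real) tensor \<Rightarrow> 'n \<Rightarrow> 'n rpoly" where
  "A_poly m A = tensor_apply m (\<lambda>is. pConst (A is)) pVar"

text \<open>The exponent \<open>m\<^sub>0 - m + 1\<close> is \<open>0\<close> or \<open>1\<close>; it is written so that nothing is truncated.\<close>

definition f_poly :: "nat \<Rightarrow> ('n::finite, real) tensor \<Rightarrow> 'n rpoly" where
  "f_poly m A = (\<Sum>j\<in>UNIV. pVar j ^ (m0 m + 1 - m) * A_poly m A j)"

text \<open>The tuple \<open>h\<close>; its last entry has the index \<open>None\<close>.\<close>

fun h_poly :: "nat \<Rightarrow> ('n::finite, real) tensor \<Rightarrow> 'n option \<Rightarrow> 'n rpoly" where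
  "h_poly m A (Some j) = A_poly m A j - f_poly m A * pVar j ^ (m - 1)"
| "h_poly m A None = (\<Sum>j\<in>UNIV. pVar j ^ m0 m) - 1"

text \<open>
  The feasible set of \<open>(P\<^sub>k)\<close> with threshold \<open>c = \<mu>\<^sub>i + \<delta>\<close>.  Vectors
  indexed by \<open>expos_upto (2 * k)\<close> are functions \<open>undefined\<close> outside this set.
\<close>

definition P_feasible :: "nat \<Rightarrow> ('n::finite, real) tensor \<Rightarrow> real \<Rightarrow> nat \<Rightarrow> ('n expo \<Rightarrow> real) set" where
  "P_feasible m A c k =
     {z \<in> extensional (expos_upto (2 * k)).
        pairing 1 z = 1 \<and>
        (\<forall>j. loc_zero k (h_poly m A j) z) \<and>
        loc_psd k 1 z \<and>
        loc_psd k (f_poly m A - pConst c) z}"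

subsection \<open>Existence and uniqueness of localizing matrices\<close>

lemma finite_expos_upto [simp]: "finite (expos_upto d :: 'n::finite expo set)"
proof -
  have "inj_on lookup (expos_upto d :: 'n expo set)"
    by (auto intro!: inj_onI poly_mapping_eqI)
  moreover have "lookup ` (expos_upto d :: 'n expo set) \<subseteq> (UNIV :: 'n set) \<rightarrow>\<^sub>E {..d}"
  proof (rule image_subsetI)
    fix a :: "'n expo" assume "a \<in> expos_upto d"
    then have d: "(\<Sum>i\<in>UNIV. lookup a i) \<le> d" by (simp add: expos_upto_def expo_deg_def)
    have "lookup a i \<le> d" for i
      by (rule order_trans[OF member_le_sum d]) auto
    then show "lookup a \<in> (UNIV :: 'n set) \<rightarrow>\<^sub>E {..d}" by auto
  qed
  moreover have "finite ((UNIV :: 'n set) \<rightarrow>\<^sub>E {..d})"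
    by (intro finite_PiE) auto
  ultimately show ?thesis
    by (metis finite_imageD finite_subset)
qed

lemma expo_deg_add: "expo_deg (a + b) = expo_deg a + expo_deg b"
  by (simp add: expo_deg_def lookup_add sum.distrib)

lemma expo_deg_le: "a \<in> keys p \<Longrightarrow> expo_deg a \<le> rpoly_deg p"
  by (simp add: rpoly_deg_def)

lemma rpoly_deg_leI: "(\<And>a. a \<in> keys p \<Longrightarrow> expo_deg a \<le> d) \<Longrightarrow> rpoly_deg p \<le> d"
  by (simp add: rpoly_deg_def)

lemma rpoly_deg_attained:
  assumes "p \<noteq> 0"
  obtains a where "a \<in> keys p" "expo_deg a = rpoly_deg p"
proof -
  have ne: "keys p \<noteq> {}" using assms
    by (metis empty_iff in_keys_iff lookup_zero poly_mapping_eqI)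
  have "rpoly_deg p = Max (expo_deg ` keys p)"
    using ne by (simp add: rpoly_deg_def)
  also have "\<dots> \<in> expo_deg ` keys p" using ne by (intro Max_in) auto
  finally show ?thesis using that by auto
qed

lemma lookup_mult_keys:
  "lookup (p * q) c = (\<Sum>a\<in>keys p. \<Sum>b\<in>keys q. if a + b = c then lookup p a * lookup q b else 0)"
  for p q :: "'n::finite rpoly"
proof -
  have q: "(\<Sum>b. lookup q b when c = a + b) = (\<Sum>b\<in>keys q. if a + b = c then lookup q b else 0)" for a
    by (subst Sum_any.expand_superset[of "keys q"])
      (auto simp: when_def in_keys_iff intro!: sum.cong)
  have "lookup (p * q) c = (\<Sum>a. lookup p a * (\<Sum>b\<in>keys q. if a + b = c then lookup q b else 0))"
    unfolding lookup_mult q ..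
  also have "\<dots> = (\<Sum>a\<in>keys p. lookup p a * (\<Sum>b\<in>keys q. if a + b = c then lookup q b else 0))"
    by (rule Sum_any.expand_superset) (auto simp: in_keys_iff)
  also have "\<dots> = (\<Sum>a\<in>keys p. \<Sum>b\<in>keys q. if a + b = c then lookup p a * lookup q b else 0)"
    by (auto simp: sum_distrib_left intro!: sum.cong)
  finally show ?thesis .
qed

lemma pairing_superset:
  assumes "finite S" "keys p \<subseteq> S"
  shows "pairing p z = (\<Sum>a\<in>S. lookup p a * z a)"
  unfolding pairing_def using assms by (intro sum.mono_neutral_left) (auto simp: in_keys_iff)

lemma pairing_mult:
  "pairing (p * q) z = (\<Sum>a\<in>keys p. \<Sum>b\<in>keys q. lookup p a * lookup q b * z (a + b))"
proof -
  let ?S = "(\<lambda>(a, b). a + b) ` (keys p \<times> keys q)"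
  have S: "finite ?S" by simp
  have sub: "keys (p * q) \<subseteq> ?S" using keys_mult[of p q] by auto
  have "pairing (p * q) z = (\<Sum>c\<in>?S. lookup (p * q) c * z c)"
    by (rule pairing_superset[OF S sub])
  also have "\<dots> = (\<Sum>c\<in>?S. \<Sum>a\<in>keys p. \<Sum>b\<in>keys q.
      if a + b = c then lookup p a * lookup q b * z c else 0)"
    unfolding lookup_mult_keys by (auto simp: sum_distrib_right intro!: sum.cong)
  also have "\<dots> = (\<Sum>a\<in>keys p. \<Sum>b\<in>keys q. \<Sum>c\<in>?S.
      if a + b = c then lookup p a * lookup q b * z c else 0)"
    by (subst sum.swap, rule sum.cong[OF refl], subst sum.swap, rule refl)
  also have "\<dots> = (\<Sum>a\<in>keys p. \<Sum>b\<in>keys q. lookup p a * lookup q b * z (a + b))"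
    by (intro sum.cong refl, subst sum.delta'[OF S]) auto
  finally show ?thesis .
qed

text \<open>A weight vector that separates finitely many exponents.\<close>

lemma separating_weight:
  fixes E :: "'n::finite expo set"
  assumes "finite E"
  obtains w :: "'n \<Rightarrow> real" where
    "inj_on (\<lambda>a. \<Sum>i\<in>UNIV. real (lookup a i) * w i) E"
proof -
  let ?v = "\<lambda>a b. (\<chi> i. real (lookup a i) - real (lookup b i)) :: real ^ 'n"
  let ?D = "(\<lambda>(a, b). ?v a b) ` {(a, b). a \<in> E \<and> b \<in> E \<and> a \<noteq> b}"
  have fin: "finite ?D"
    by (rule finite_imageI, rule finite_subset[of _ "E \<times> E"]) (use assms in auto)
  have nz: "d \<noteq> 0" if "d \<in> ?D" for d
  proof -
    from that obtain a b where ab: "d = ?v a b" "a \<noteq> b" by auto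
    then obtain i where "lookup a i \<noteq> lookup b i" by (meson poly_mapping_eqI)
    then have "d $ i \<noteq> 0" using ab by simp
    then show ?thesis by auto
  qed
  have "negligible (\<Union>d\<in>?D. {x. d \<bullet> x = 0})"
    using fin nz by (intro negligible_Union) (auto intro!: negligible_hyperplane)
  then have "(\<Union>d\<in>?D. {x. d \<bullet> x = 0}) \<noteq> UNIV"
    using non_negligible_UNIV by metis
  then obtain w where w: "\<And>d. d \<in> ?D \<Longrightarrow> d \<bullet> w \<noteq> 0" by blast
  have "inj_on (\<lambda>a. \<Sum>i\<in>UNIV. real (lookup a i) * (w $ i)) E"
  proof (rule inj_onI, rule ccontr)
    fix a b assume ab: "a \<in> E" "b \<in> E" "a \<noteq> b"
      and eq: "(\<Sum>i\<in>UNIV. real (lookup a i) * (w $ i)) = (\<Sum>i\<in>UNIV. real (lookup b i) * (w $ i))"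
    have "?v a b \<in> ?D" using ab by auto
    moreover have "?v a b \<bullet> w = 0"
      using eq by (simp add: inner_vec_def left_diff_distrib sum_subtractf)
    ultimately show False using w by blast
  qed
  then show ?thesis by (rule that)
qed

lemma rpoly_deg_mult:
  fixes p q :: "'n::finite rpoly"
  assumes "p \<noteq> 0" "q \<noteq> 0"
  shows "rpoly_deg (p * q) = rpoly_deg p + rpoly_deg q" and "p * q \<noteq> 0"
proof -
  obtain w :: "'n \<Rightarrow> real" where w: "inj_on (\<lambda>a. \<Sum>i\<in>UNIV. real (lookup a i) * w i) (keys p \<union> keys q)"
    by (rule separating_weight[of "keys p \<union> keys q"]) auto
  define W where "W = (\<lambda>a :: 'n expo. \<Sum>i\<in>UNIV. real (lookup a i) * w i)"
  have W_add: "W (a + b) = W a + W b" for a b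
    by (simp add: W_def lookup_add distrib_right sum.distrib)
  have top: "\<exists>a\<in>keys r. expo_deg a = rpoly_deg r \<and>
      (\<forall>b\<in>keys r. expo_deg b = rpoly_deg r \<longrightarrow> b \<noteq> a \<longrightarrow> W b < W a)"
    if "r \<noteq> 0" "inj_on W (keys r)" for r :: "'n rpoly"
  proof -
    let ?T = "{a \<in> keys r. expo_deg a = rpoly_deg r}"
    have T: "finite ?T" "?T \<noteq> {}" using rpoly_deg_attained[OF that(1)] by auto
    define M where "M = Max (W ` ?T)"
    have "M \<in> W ` ?T" unfolding M_def using T by (intro Max_in) auto
    then obtain a where a: "a \<in> ?T" "W a = M" by auto
    have "W b < W a" if "b \<in> ?T" "b \<noteq> a" for b
    proof -
      have "W b \<le> M" unfolding M_def using T that by (intro Max_ge) auto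
      moreover have "W b \<noteq> W a" using \<open>inj_on W (keys r)\<close> that a by (auto dest: inj_onD)
      ultimately show ?thesis using a by linarith
    qed
    then show ?thesis using a by auto
  qed
  obtain a where a: "a \<in> keys p" "expo_deg a = rpoly_deg p"
    "\<And>b. b \<in> keys p \<Longrightarrow> expo_deg b = rpoly_deg p \<Longrightarrow> b \<noteq> a \<Longrightarrow> W b < W a"
    using top[OF assms(1)] w inj_on_subset[of W "keys p \<union> keys q" "keys p"]
    unfolding W_def by blast
  obtain b where b: "b \<in> keys q" "expo_deg b = rpoly_deg q"
    "\<And>c. c \<in> keys q \<Longrightarrow> expo_deg c = rpoly_deg q \<Longrightarrow> c \<noteq> b \<Longrightarrow> W c < W b"
    using top[OF assms(2)] w inj_on_subset[of W "keys p \<union> keys q" "keys q"]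
    unfolding W_def by blast
  have uniq: "a' = a \<and> b' = b" if "a' \<in> keys p" "b' \<in> keys q" "a' + b' = a + b" for a' b'
  proof -
    have "expo_deg a' + expo_deg b' = expo_deg a + expo_deg b"
      using that by (metis expo_deg_add)
    then have d: "expo_deg a' = rpoly_deg p" "expo_deg b' = rpoly_deg q"
      using that a(2) b(2) expo_deg_le[of a' p] expo_deg_le[of b' q] by auto
    have "W a' + W b' = W a + W b" using that by (metis W_add)
    then show ?thesis
      using a(3)[of a'] b(3)[of b'] that d by (cases "a' = a"; cases "b' = b") auto
  qed
  have "lookup (p * q) (a + b) =
      (\<Sum>a'\<in>keys p. \<Sum>b'\<in>keys q. if a' = a \<and> b' = b then lookup p a' * lookup q b' else 0)"
    unfolding lookup_mult_keys by (intro sum.cong refl) (use uniq in auto)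
  also have "\<dots> = (\<Sum>a'\<in>keys p. if a' = a then lookup p a * lookup q b else 0)"
    using b by (intro sum.cong refl) (auto simp: sum.delta)
  also have "\<dots> = lookup p a * lookup q b" using a by simp
  finally have "lookup (p * q) (a + b) \<noteq> 0" using a b by (simp add: in_keys_iff)
  then have ab: "a + b \<in> keys (p * q)" by (simp add: in_keys_iff)
  then show "p * q \<noteq> 0" by auto
  have "rpoly_deg p + rpoly_deg q \<le> rpoly_deg (p * q)"
    using expo_deg_le[OF ab] a b by (simp add: expo_deg_add)
  moreover have "rpoly_deg (p * q) \<le> rpoly_deg p + rpoly_deg q"
  proof (rule rpoly_deg_leI)
    fix c assume "c \<in> keys (p * q)"
    then obtain a' b' where "c = a' + b'" "a' \<in> keys p" "b' \<in> keys q"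
      using keys_mult[of p q] by blast
    then show "expo_deg c \<le> rpoly_deg p + rpoly_deg q"
      by (simp add: expo_deg_add add_mono expo_deg_le)
  qed
  ultimately show "rpoly_deg (p * q) = rpoly_deg p + rpoly_deg q" by simp
qed

lemma rpoly_deg_mult_square:
  fixes p q :: "'n::finite rpoly"
  assumes "q \<noteq> 0" "rpoly_deg q \<le> 2 * k"
  shows "rpoly_deg (q * p ^ 2) \<le> 2 * k \<longleftrightarrow> keys p \<subseteq> loc_index k q"
proof (cases "p = 0")
  case True
  then show ?thesis by (simp add: rpoly_deg_def)
next
  case False
  have "rpoly_deg (q * p ^ 2) = rpoly_deg q + 2 * rpoly_deg p"
    using rpoly_deg_mult[OF False False] rpoly_deg_mult(1)[OF assms(1), of "p * p"]
    by (simp add: power2_eq_square)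
  then have "rpoly_deg (q * p ^ 2) \<le> 2 * k \<longleftrightarrow> rpoly_deg p \<le> (2 * k - rpoly_deg q) div 2"
    using assms(2) by linarith
  also have "\<dots> \<longleftrightarrow> keys p \<subseteq> loc_index k q"
    unfolding loc_index_def expos_upto_def
    by (auto dest: expo_deg_le order_trans intro: rpoly_deg_leI)
  finally show ?thesis .
qed

definition loc_entry :: "'n::finite rpoly \<Rightarrow> ('n expo \<Rightarrow> real) \<Rightarrow> 'n expo \<Rightarrow> 'n expo \<Rightarrow> real" where
  "loc_entry q z a b = (\<Sum>c\<in>keys q. lookup q c * z (a + b + c))"

lemma pairing_mult_square:
  assumes "finite I" "keys p \<subseteq> I"
  shows "pairing (q * p ^ 2) z = (\<Sum>a\<in>I. \<Sum>b\<in>I. lookup p a * loc_entry q z a b * lookup p b)"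
proof -
  define y where "y = (\<lambda>d. \<Sum>c\<in>keys q. lookup q c * z (d + c))"
  have "pairing (q * p ^ 2) z = (\<Sum>c\<in>keys q. \<Sum>d\<in>keys (p * p). lookup q c * lookup (p * p) d * z (c + d))"
    by (simp add: pairing_mult power2_eq_square)
  also have "\<dots> = pairing (p * p) y"
    unfolding pairing_def y_def
    by (subst sum.swap) (auto simp: sum_distrib_left algebra_simps intro!: sum.cong)
  also have "\<dots> = (\<Sum>a\<in>keys p. \<Sum>b\<in>keys p. lookup p a * loc_entry q z a b * lookup p b)"
    unfolding pairing_mult y_def loc_entry_def by (simp add: mult_ac)
  also have "\<dots> = (\<Sum>a\<in>keys p. \<Sum>b\<in>I. lookup p a * loc_entry q z a b * lookup p b)"
    using assms by (intro sum.cong refl sum.mono_neutral_left) (auto simp: in_keys_iff)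
  also have "\<dots> = (\<Sum>a\<in>I. \<Sum>b\<in>I. lookup p a * loc_entry q z a b * lookup p b)"
    using assms by (intro sum.mono_neutral_left) (auto simp: in_keys_iff)
  finally show ?thesis .
qed

lemma sum_two_points:
  fixes g :: "'a \<Rightarrow> real"
  assumes "finite I" "s \<in> I" "t \<in> I"
  shows "(\<Sum>a\<in>I. (of_bool (a = s) + of_bool (a = t)) * g a) = g s + g t"
proof -
  have "(\<Sum>a\<in>I. of_bool (a = r) * g a) = g r" if "r \<in> I" for r
  proof -
    have "(\<Sum>a\<in>I. of_bool (a = r) * g a) = (\<Sum>a\<in>I. if a = r then g a else 0)"
      by (intro sum.cong) auto
    then show ?thesis using that assms(1) by simp
  qed
  then show ?thesis using assms by (simp only: distrib_right sum.distrib)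
qed

theorem localizing_matrix_unique:
  fixes q :: "'n::finite rpoly"
  assumes deg: "rpoly_deg q \<le> 2 * k"
  shows "is_localizing_matrix k q z L \<longleftrightarrow>
    L = (\<lambda>a b. if a \<in> loc_index k q \<and> b \<in> loc_index k q then loc_entry q z a b else 0)"
    (is "_ \<longleftrightarrow> L = ?L")
proof
  let ?I = "loc_index k q"
  have fin: "finite ?I" by (simp add: loc_index_def)
  have sym: "loc_entry q z a b = loc_entry q z b a" for a b
    by (simp add: loc_entry_def add.commute)
  have quad: "pairing (q * p ^ 2) z = (\<Sum>a\<in>?I. \<Sum>b\<in>?I. lookup p a * loc_entry q z a b * lookup p b)"
    if "rpoly_deg (q * p ^ 2) \<le> 2 * k" for p
  proof (cases "q = 0")
    case True
    then show ?thesis by (simp add: pairing_def loc_entry_def)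
  next
    case False
    then show ?thesis
      using rpoly_deg_mult_square[OF False deg] that pairing_mult_square[OF fin] by blast
  qed
  have L: "is_localizing_matrix k q z ?L"
    unfolding is_localizing_matrix_def using quad sym by auto
  then show "is_localizing_matrix k q z L" if "L = ?L" using that by simp
  show "L = ?L" if "is_localizing_matrix k q z L"
  proof -
    define D where "D = (\<lambda>a b. L a b - ?L a b)"
    have symL: "L a b = L b a" for a b
      using that unfolding is_localizing_matrix_def by blast
    have symD: "D a b = D b a" for a b
      unfolding D_def symL[of a b] using sym[of a b] by simp
    have outD: "D a b = 0" if "a \<notin> ?I \<or> b \<notin> ?I" for a b
      using \<open>is_localizing_matrix k q z L\<close> that unfolding D_def is_localizing_matrix_def by auto
    have deg_ok: "rpoly_deg (q * p ^ 2) \<le> 2 * k" if "keys p \<subseteq> ?I" for p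
      using that rpoly_deg_mult_square[OF _ deg, of p] by (cases "q = 0") (auto simp: rpoly_deg_def)
    have zero: "(\<Sum>a\<in>?I. \<Sum>b\<in>?I. lookup p a * D a b * lookup p b) = 0" if "keys p \<subseteq> ?I" for p
    proof -
      have "pairing (q * p ^ 2) z = (\<Sum>a\<in>?I. \<Sum>b\<in>?I. lookup p a * L a b * lookup p b)"
        using \<open>is_localizing_matrix k q z L\<close> deg_ok[OF that]
        unfolding is_localizing_matrix_def by blast
      moreover have "(\<Sum>a\<in>?I. \<Sum>b\<in>?I. lookup p a * D a b * lookup p b) =
          (\<Sum>a\<in>?I. \<Sum>b\<in>?I. lookup p a * L a b * lookup p b) -
          (\<Sum>a\<in>?I. \<Sum>b\<in>?I. lookup p a * loc_entry q z a b * lookup p b)"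
        unfolding sum_subtractf[symmetric]
        by (intro sum.cong refl) (simp add: D_def algebra_simps)
      ultimately show ?thesis using quad[OF deg_ok[OF that]] by simp
    qed
    have key: "D s s + D s t + D t s + D t t = 0" if st: "s \<in> ?I" "t \<in> ?I" for s t
    proof -
      let ?p = "Poly_Mapping.single s 1 + Poly_Mapping.single t 1 :: 'n rpoly"
      have p: "lookup ?p a = of_bool (a = s) + of_bool (a = t)" for a
        by (simp add: lookup_add lookup_single when_def of_bool_def eq_commute)
      have "keys ?p \<subseteq> ?I"
        using keys_add[of "Poly_Mapping.single s (1::real)" "Poly_Mapping.single t 1"] st by auto
      then have "(\<Sum>a\<in>?I. \<Sum>b\<in>?I. lookup ?p a * D a b * lookup ?p b) = 0" by (rule zero)
      also have "(\<Sum>a\<in>?I. \<Sum>b\<in>?I. lookup ?p a * D a b * lookup ?p b) =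
          (\<Sum>a\<in>?I. lookup ?p a * (\<Sum>b\<in>?I. lookup ?p b * D a b))"
        by (simp only: sum_distrib_left mult_ac)
      also have "\<dots> = D s s + D s t + (D t s + D t t)"
        unfolding p sum_two_points[OF fin st] ..
      finally show ?thesis by simp
    qed
    have diag: "D s s = 0" if "s \<in> ?I" for s using key[OF that that] by simp
    have "D s t = 0" for s t
    proof (cases "s \<in> ?I \<and> t \<in> ?I")
      case True
      then show ?thesis using key[of s t] diag[of s] diag[of t] symD[of s t] by simp
    next
      case False
      then show ?thesis using outD by blast
    qed
    then show ?thesis unfolding D_def by (intro ext) (rule eq_iff_diff_eq_0[THEN iffD2])
  qed
qed

corollary localizing_matrix_eq:
  assumes "rpoly_deg q \<le> 2 * k"
  shows "localizing_matrix k q z =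
    (\<lambda>a b. if a \<in> loc_index k q \<and> b \<in> loc_index k q then loc_entry q z a b else 0)"
  unfolding localizing_matrix_def localizing_matrix_unique[OF assms] by simp

corollary moment_matrix_entry:
  assumes "a \<in> expos_upto k" "b \<in> expos_upto k"
  shows "localizing_matrix k 1 z a b = z (a + b)"
  using assms
  by (subst localizing_matrix_eq) (auto simp: rpoly_deg_def expo_deg_def loc_index_def loc_entry_def)

end

theory Submission
  imports Defs "Jordan_Normal_Form.Char_Poly"
begin

text \<open>
  Once the set of real H-eigenvalues is known to be finite, \<open>\<upsilon>\<^sub>i = \<mu>\<^sub>i\<close> says that no eigenvalue lies in
  \<open>(\<mu>\<^sub>i, \<mu>\<^sub>i + \<delta>]\<close>, which gives (i).  For (ii), an eigenvalue \<open>\<nu> > \<mu>\<^sub>i\<close> then satisfies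
  \<open>\<nu> \<ge> \<mu>\<^sub>i + \<delta>\<close>, and scaling its eigenvector \<open>x\<close> to \<open>\<Sum>j. x\<^sub>j ^ m\<^sub>0 = 1\<close> makes \<open>h\<close> vanish at \<open>x\<close>
  and \<open>f(x) = \<nu>\<close>; the moment vector of the point mass at \<open>x\<close> is therefore feasible for every
  \<open>k \<ge> k\<^sub>0\<close>.
\<close>

no_notation Matrix.vec_index (infixl "$" 100)

section \<open>Finiteness of the set of real H-eigenvalues\<close>

text \<open>Enumerating \<open>I\<close> turns \<open>M\<close> into an ordinary square matrix; each
  such \<open>l\<close> is a root of its characteristic polynomial, which is monic and hence
  nonzero. The index set is left arbitrary so that it can consist of monomials.\<close>

lemma finite_eigenvalues_on:
  fixes M :: "'a \<Rightarrow> 'a \<Rightarrow> real"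
  assumes "finite I"
  shows "finite {l. \<exists>v. (\<exists>a\<in>I. v a \<noteq> 0) \<and> (\<forall>a\<in>I. (\<Sum>b\<in>I. M a b * v b) = l * v a)}"
proof -
  let ?n = "card I"
  obtain e where e: "bij_betw e {0..<?n} I"
    using ex_bij_betw_nat_finite[OF assms] by blast
  define B where "B = Matrix.mat ?n ?n (\<lambda>(i, j). M (e i) (e j))"
  have B: "B \<in> carrier_mat ?n ?n" by (simp add: B_def)
  have "char_poly B \<noteq> 0"
    using degree_monic_char_poly[OF B] by (metis coeff_0 zero_neq_one)
  then have fin: "finite {l. poly (char_poly B) l = 0}" by (rule poly_roots_finite)
  have "poly (char_poly B) l = 0"
    if a: "a \<in> I" "v a \<noteq> 0" and v: "\<forall>a\<in>I. (\<Sum>b\<in>I. M a b * v b) = l * v a" for l v a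
  proof -
    define w where "w = Matrix.vec ?n (\<lambda>i. v (e i))"
    obtain i where i: "i < ?n" "e i = a"
      using a(1) e by (force simp: bij_betw_def)
    have "w \<noteq> 0\<^sub>v ?n"
      using i a(2) by (metis index_vec index_zero_vec(1) w_def)
    moreover have "B *\<^sub>v w = l \<cdot>\<^sub>v w"
    proof (rule eq_vecI)
      fix i assume "i < dim_vec (l \<cdot>\<^sub>v w)"
      then have i: "i < ?n" by (simp add: w_def)
      then have "e i \<in> I" using e by (auto simp: bij_betw_def)
      have "(\<Sum>j\<in>{0..<?n}. M (e i) (e j) * v (e j)) = (\<Sum>b\<in>I. M (e i) b * v b)"
        by (rule sum.reindex_bij_betw[OF e])
      also have "\<dots> = l * v (e i)" using v \<open>e i \<in> I\<close> by blast
      finally show "vec_index (B *\<^sub>v w) i = vec_index (l \<cdot>\<^sub>v w) i"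
        using i by (simp add: B_def w_def scalar_prod_def)
    qed (simp add: B_def w_def)
    ultimately have "eigenvalue B l"
      unfolding eigenvalue_def eigenvector_def by (intro exI[of _ w]) (simp add: B_def w_def)
    then show ?thesis using eigenvalue_root_char_poly[OF B] by blast
  qed
  then show ?thesis by (intro finite_subset[OF _ fin] subsetI) auto
qed

definition monom_eval :: "('n::finite \<Rightarrow> real) \<Rightarrow> 'n expo \<Rightarrow> real" where
  "monom_eval x a = (\<Prod>i\<in>UNIV. x i ^ lookup a i)"

lemma monom_eval_0 [simp]: "monom_eval x 0 = 1"
  by (simp add: monom_eval_def)

lemma monom_eval_add: "monom_eval x (a + b) = monom_eval x a * monom_eval x b"
  by (simp add: monom_eval_def lookup_add power_add prod.distrib)

lemma monom_eval_single [simp]: "monom_eval x (Poly_Mapping.single i d) = x i ^ d"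
proof -
  have "monom_eval x (Poly_Mapping.single i d) = (\<Prod>j\<in>UNIV. if j = i then x j ^ d else 1)"
    unfolding monom_eval_def by (intro prod.cong) (auto simp: lookup_single when_def)
  then show ?thesis by simp
qed

lemma expo_deg_0 [simp]: "expo_deg 0 = 0"
  by (simp add: expo_deg_def)

lemma expo_deg_single [simp]: "expo_deg (Poly_Mapping.single i d) = d"
  by (simp add: expo_deg_def lookup_single when_def)

text \<open>This is the exponent of the monomial attached to a tensor index list; permuted lists
  share one exponent.\<close>

definition list_expo :: "'n::finite list \<Rightarrow> 'n expo" where
  "list_expo is = (\<Sum>i\<leftarrow>is. Poly_Mapping.single i 1)"

lemma monom_eval_list_expo: "monom_eval x (list_expo is) = (\<Prod>i\<leftarrow>is. x i)"
  by (induction "is") (simp_all add: list_expo_def monom_eval_add)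

lemma expo_deg_list_expo: "expo_deg (list_expo is) = length is"
  by (induction "is") (simp_all add: list_expo_def expo_deg_add)

lemma finite_lists_length [simp]: "finite {is :: 'n::finite list. length is = d}"
  using finite_lists_length_eq[of "UNIV :: 'n set" d] by simp

text \<open>
  Every monomial of degree \<open>n(m - 2) + 1\<close> is divisible by some \<open>x\<^sub>j\<^sup>m\<^sup>-\<^sup>1\<close>.  Replacing this factor by
  the \<open>j\<close>-th entry of the eigenvalue equation turns the vector of these monomials, evaluated at a
  real H-eigenvector, into an eigenvector of a matrix that does not depend on the eigenpair.
\<close>

theorem finite_H_eigenvalues:
  fixes A :: "('n::finite, real) tensor"
  assumes "m \<ge> 2"
  shows "finite (H_eigenvalues m A)"
proof -
  define d where "d = m - 1"
  define D where "D = CARD('n) * (d - 1) + 1"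
  define I where "I = {a :: 'n expo. expo_deg a = D}"
  have d: "d > 0" using assms by (simp add: d_def)
  have finI: "finite I"
    by (rule finite_subset[OF _ finite_expos_upto[of D]]) (auto simp: I_def expos_upto_def)
  \<comment> \<open>Pigeonhole: exponents all below \<open>d\<close> add up to at most
    \<open>CARD('n) * (d - 1)\<close>, one less than \<open>D\<close>.\<close>
  have "\<exists>j. d \<le> lookup a j" if "a \<in> I" for a
  proof (rule ccontr)
    assume "\<not> ?thesis"
    then have lt: "lookup a j < d" for j by (simp add: not_le)
    have "lookup a j \<le> d - 1" for j using lt[of j] by linarith
    then have "expo_deg a \<le> (\<Sum>j::'n\<in>UNIV. d - 1)"
      unfolding expo_deg_def by (intro sum_mono) auto
    then show False using that by (simp add: I_def D_def)
  qed
  then obtain J where J: "\<And>a. a \<in> I \<Longrightarrow> d \<le> lookup a (J a)" by metis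
  define R where "R = (\<lambda>a. a - Poly_Mapping.single (J a) d)"
  have R: "a = Poly_Mapping.single (J a) d + R a" if "a \<in> I" for a
    unfolding R_def
    by (rule poly_mapping_eqI)
      (use J[OF that] in \<open>auto simp: lookup_add lookup_minus lookup_single when_def\<close>)
  \<comment> \<open>Row \<open>a\<close> expands the tensor entry \<open>J a\<close> times the
    monomial \<open>R a\<close>. Distinct lists can yield the same monomial \<open>b\<close>, hence
    the sum.\<close>
  define M where "M = (\<lambda>a b. \<Sum>is | length is = d. if list_expo is + R a = b then A (J a # is) else 0)"
  have "\<exists>v. (\<exists>a\<in>I. v a \<noteq> 0) \<and> (\<forall>a\<in>I. (\<Sum>b\<in>I. M a b * v b) = l * v a)"
    if "H_eigenpair m A l u" for l u
  proof (intro exI conjI ballI)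
    let ?v = "monom_eval (($) u)"
    have "u \<noteq> 0" using that by (simp add: H_eigenpair_def)
    then obtain i where i: "u $ i \<noteq> 0"
      by (metis Finite_Cartesian_Product.vec_eq_iff zero_index)
    \<comment> \<open>The pure power of a nonzero coordinate of \<open>u\<close> is a monomial of
      the right degree.\<close>
    show "\<exists>a\<in>I. ?v a \<noteq> 0"
      by (rule bexI[of _ "Poly_Mapping.single i D"]) (use i in \<open>auto simp: I_def\<close>)
    fix a assume a: "a \<in> I"
    have eq: "tensor_apply m A (($) u) j = l * (u $ j) ^ d" for j
      using that by (simp add: H_eigenpair_def Finite_Cartesian_Product.vec_eq_iff d_def)
    have in_I: "list_expo is + R a \<in> I" if "length is = d" for "is"
    proof -
      have "expo_deg a = d + expo_deg (R a)"
        by (subst R[OF a]) (simp add: expo_deg_add)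
      then show ?thesis using a that by (simp add: I_def expo_deg_add expo_deg_list_expo)
    qed
    have "(\<Sum>b\<in>I. M a b * ?v b) =
        (\<Sum>is | length is = d. \<Sum>b\<in>I. if list_expo is + R a = b then A (J a # is) * ?v b else 0)"
      unfolding M_def sum_distrib_right
      by (subst sum.swap) (intro sum.cong refl, simp)
    also have "\<dots> = (\<Sum>is | length is = d. A (J a # is) * ?v (list_expo is + R a))"
      by (intro sum.cong refl) (use in_I finI in simp)
    also have "\<dots> = tensor_apply m A (($) u) (J a) * ?v (R a)"
      by (simp add: tensor_apply_def d_def monom_eval_add monom_eval_list_expo sum_distrib_right mult.assoc)
    also have "\<dots> = l * ?v a"
      \<comment> \<open>Only the \<open>a\<close> on the right-hand side is split; the other two sit
        inside \<open>J a\<close> and \<open>R a\<close>.\<close>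
      by (subst (3) R[OF a]) (simp add: eq monom_eval_add)
    finally show "(\<Sum>b\<in>I. M a b * ?v b) = l * ?v a" .
  qed
  then have "H_eigenvalues m A \<subseteq>
      {l. \<exists>v. (\<exists>a\<in>I. v a \<noteq> 0) \<and> (\<forall>a\<in>I. (\<Sum>b\<in>I. M a b * v b) = l * v a)}"
    unfolding H_eigenvalues_def by blast
  then show ?thesis using finite_eigenvalues_on[OF finI] by (rule finite_subset)
qed

section \<open>Evaluation of polynomials at a point\<close>

text \<open>With this encoding, evaluation at \<open>x\<close> is literally the linear functional
  given by the moments of the point mass at \<open>x\<close>.\<close>

definition rpoly_eval :: "('n::finite \<Rightarrow> real) \<Rightarrow> 'n rpoly \<Rightarrow> real" where
  "rpoly_eval x p = pairing p (monom_eval x)"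

lemma rpoly_eval_add: "rpoly_eval x (p + q) = rpoly_eval x p + rpoly_eval x q"
proof -
  let ?S = "keys p \<union> keys q"
  have "pairing r (monom_eval x) = (\<Sum>a\<in>?S. lookup r a * monom_eval x a)"
    if "keys r \<subseteq> ?S" for r
    using that by (intro pairing_superset) auto
  then show ?thesis
    by (simp add: rpoly_eval_def Poly_Mapping.keys_add lookup_add distrib_right sum.distrib)
qed

lemma rpoly_eval_mult: "rpoly_eval x (p * q) = rpoly_eval x p * rpoly_eval x q"
  by (simp add: rpoly_eval_def pairing_mult monom_eval_add sum_product mult_ac)
    (simp add: pairing_def sum_product mult_ac)

lemma rpoly_eval_0 [simp]: "rpoly_eval x 0 = 0"
  by (simp add: rpoly_eval_def pairing_def)

lemma rpoly_eval_1 [simp]: "rpoly_eval x 1 = 1"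
  by (simp add: rpoly_eval_def pairing_def)

lemma rpoly_eval_diff: "rpoly_eval x (p - q) = rpoly_eval x p - rpoly_eval x q"
  using rpoly_eval_add[of x "p - q" q] by simp

lemma rpoly_eval_sum: "rpoly_eval x (\<Sum>i\<in>S. p i) = (\<Sum>i\<in>S. rpoly_eval x (p i))"
  by (induction S rule: infinite_finite_induct) (simp_all add: rpoly_eval_add)

lemma rpoly_eval_power: "rpoly_eval x (p ^ d) = rpoly_eval x p ^ d"
  by (induction d) (simp_all add: rpoly_eval_mult)

lemma rpoly_eval_prod_list: "rpoly_eval x (\<Prod>i\<leftarrow>is. p i) = (\<Prod>i\<leftarrow>is. rpoly_eval x (p i))"
  by (induction "is") (simp_all add: rpoly_eval_mult)

lemma rpoly_eval_pConst [simp]: "rpoly_eval x (pConst c) = c"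
  by (simp add: rpoly_eval_def pairing_def pConst_def)

lemma rpoly_eval_pVar [simp]: "rpoly_eval x (pVar i) = x i"
  by (simp add: rpoly_eval_def pairing_def pVar_def)

lemma rpoly_eval_A_poly: "rpoly_eval x (A_poly m A j) = tensor_apply m A x j"
  by (simp add: A_poly_def tensor_apply_def rpoly_eval_sum rpoly_eval_mult rpoly_eval_prod_list)

section \<open>Degree bounds for the polynomials of the relaxation\<close>

lemma rpoly_deg_0 [simp]: "rpoly_deg 0 = 0"
  by (simp add: rpoly_deg_def)

lemma rpoly_deg_1 [simp]: "rpoly_deg 1 = 0"
  by (simp add: rpoly_deg_def)

lemma rpoly_deg_pConst [simp]: "rpoly_deg (pConst c) = 0"
  by (simp add: rpoly_deg_def pConst_def)

lemma rpoly_deg_pVar [simp]: "rpoly_deg (pVar i) = 1"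
  by (simp add: rpoly_deg_def pVar_def)

lemma rpoly_deg_add_le:
  assumes "rpoly_deg p \<le> d" "rpoly_deg q \<le> d"
  shows "rpoly_deg (p + q) \<le> d"
proof (rule rpoly_deg_leI)
  fix a assume "a \<in> keys (p + q)"
  then have "a \<in> keys p \<or> a \<in> keys q" using Poly_Mapping.keys_add[of p q] by blast
  then show "expo_deg a \<le> d" using assms expo_deg_le order_trans by blast
qed

lemma rpoly_deg_diff_le:
  assumes "rpoly_deg p \<le> d" "rpoly_deg q \<le> d"
  shows "rpoly_deg (p - q) \<le> d"
proof -
  have "rpoly_deg (- q) = rpoly_deg q" by (simp add: rpoly_deg_def)
  then show ?thesis using rpoly_deg_add_le[of p d "- q"] assms by simp
qed

lemma rpoly_deg_sum_le:
  assumes "\<And>i. i \<in> S \<Longrightarrow> rpoly_deg (p i) \<le> d"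
  shows "rpoly_deg (\<Sum>i\<in>S. p i) \<le> d"
  using assms by (induction S rule: infinite_finite_induct) (simp_all add: rpoly_deg_add_le)

text \<open>Nonzero factors give equality; a zero factor makes the product zero, whose degree is
  \<open>0\<close> by convention.\<close>

lemma rpoly_deg_mult_le: "rpoly_deg (p * q) \<le> rpoly_deg p + rpoly_deg q"
  by (cases "p = 0 \<or> q = 0") (auto simp: rpoly_deg_mult)

lemma rpoly_deg_power_pVar: "rpoly_deg (pVar i ^ d) \<le> d"
proof (induction d)
  case (Suc d)
  then show ?case using rpoly_deg_mult_le[of "pVar i" "pVar i ^ d"] by simp
qed simp

lemma rpoly_deg_prod_list_pVar: "rpoly_deg (\<Prod>i\<leftarrow>is. pVar i) \<le> length is"
proof (induction "is")
  case (Cons i "is")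
  then show ?case using rpoly_deg_mult_le[of "pVar i" "\<Prod>i\<leftarrow>is. pVar i"] by simp
qed simp

lemma rpoly_deg_A_poly: "rpoly_deg (A_poly m A j) \<le> m - 1"
  unfolding A_poly_def tensor_apply_def
proof (rule rpoly_deg_sum_le)
  fix "is" :: "'a list" assume "is \<in> {is. length is = m - 1}"
  then show "rpoly_deg (pConst (A (j # is)) * (\<Prod>i\<leftarrow>is. pVar i)) \<le> m - 1"
    using rpoly_deg_mult_le[of "pConst (A (j # is))" "\<Prod>i\<leftarrow>is. pVar i"]
      rpoly_deg_prod_list_pVar[of "is"] by simp
qed

lemma m0_eq: "m0 m = 2 * (m div 2)"
proof -
  have "\<lceil>(real m - 1) / 2\<rceil> = int (m div 2)"
    by (cases "even m"; elim evenE oddE; simp add: ceiling_unique)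
  then show ?thesis by (simp add: m0_def)
qed

text \<open>The left side will bound the degrees of all entries of \<open>h\<close>, so that
  \<open>localizing_matrix_eq\<close> applies to them whenever \<open>k \<ge> k0 m\<close>.\<close>

lemma two_k0_ge: "m0 m + m - 1 \<le> 2 * k0 m"
proof -
  have "(real (m0 m) + real m - 1) / 2 \<le> real (k0 m)"
    unfolding k0_def by (rule real_nat_ceiling_ge)
  \<comment> \<open>The \<open>1\<close> is moved to the right before returning to natural numbers,
    which avoids truncated subtraction.\<close>
  then have "real (m0 m + m) \<le> real (2 * k0 m + 1)" by simp
  then have "m0 m + m \<le> 2 * k0 m + 1" by (rule of_nat_le_iff[THEN iffD1])
  then show ?thesis by linarith
qed

lemma rpoly_deg_f_poly:
  assumes "m \<ge> 2"
  shows "rpoly_deg (f_poly m A) \<le> m0 m"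
  unfolding f_poly_def
proof (rule rpoly_deg_sum_le)
  fix j
  have "rpoly_deg (pVar j ^ (m0 m + 1 - m) * A_poly m A j) \<le> (m0 m + 1 - m) + (m - 1)"
    using rpoly_deg_mult_le add_mono[OF rpoly_deg_power_pVar rpoly_deg_A_poly] order_trans by blast
  \<comment> \<open>\<open>m0 m\<close> is \<open>m\<close> or \<open>m - 1\<close>, so neither
    subtraction truncates.\<close>
  also have "\<dots> = m0 m" using assms m0_eq[of m] by linarith
  finally show "rpoly_deg (pVar j ^ (m0 m + 1 - m) * A_poly m A j) \<le> m0 m" .
qed

lemma rpoly_deg_h_poly:
  assumes "m \<ge> 2"
  shows "rpoly_deg (h_poly m A i) \<le> m0 m + m - 1"
proof (cases i)
  case None
  have "rpoly_deg ((\<Sum>j\<in>UNIV. pVar j ^ m0 m) - 1 :: 'a rpoly) \<le> m0 m"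
    by (intro rpoly_deg_diff_le rpoly_deg_sum_le rpoly_deg_power_pVar) simp
  then show ?thesis using None assms by simp
next
  case (Some j)
  have "rpoly_deg (f_poly m A * pVar j ^ (m - 1)) \<le> m0 m + (m - 1)"
    using rpoly_deg_mult_le add_mono[OF rpoly_deg_f_poly[OF assms] rpoly_deg_power_pVar] order_trans
    by blast
  moreover have "rpoly_deg (A_poly m A j) \<le> m0 m + (m - 1)"
    using rpoly_deg_A_poly[of m A j] by simp
  ultimately show ?thesis using Some assms by (simp add: rpoly_deg_diff_le)
qed

section \<open>Moment vectors of point masses\<close>

text \<open>The restriction supplies the value \<open>undefined\<close> beyond degree
  \<open>2 * k\<close> that \<open>P_feasible\<close> requires.\<close>

definition point_moments :: "nat \<Rightarrow> ('n::finite \<Rightarrow> real) \<Rightarrow> 'n expo \<Rightarrow> real" where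
  "point_moments k x = restrict (monom_eval x) (expos_upto (2 * k))"

text \<open>For a point mass the localizing matrix is \<open>q(x)\<close> times the rank-one matrix
  formed from the vector of monomials at \<open>x\<close>.\<close>

lemma localizing_matrix_point_moments:
  assumes q: "rpoly_deg q \<le> 2 * k" and ab: "a \<in> loc_index k q" "b \<in> loc_index k q"
  shows "localizing_matrix k q (point_moments k x) a b =
    monom_eval x a * rpoly_eval x q * monom_eval x b"
proof -
  \<comment> \<open>The entries use only moments inside the truncation, because \<open>a\<close> and
    \<open>b\<close> together have degree at most \<open>2 * k - rpoly_deg q\<close>.\<close>
  have "a + b + c \<in> expos_upto (2 * k)" if "c \<in> keys q" for c
    using ab q expo_deg_le[OF that]
    by (simp add: loc_index_def expos_upto_def expo_deg_add)
  then show ?thesis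
    using ab by (simp add: localizing_matrix_eq[OF q] loc_entry_def point_moments_def
        rpoly_eval_def pairing_def monom_eval_add sum_distrib_left sum_distrib_right mult_ac)
qed

lemma loc_zero_point_moments:
  assumes "rpoly_deg q \<le> 2 * k" "rpoly_eval x q = 0"
  shows "loc_zero k q (point_moments k x)"
  using assms by (simp add: loc_zero_def localizing_matrix_point_moments)

text \<open>By the rank-one form, the quadratic form is \<open>q(x)\<close> times a square.\<close>

lemma loc_psd_point_moments:
  assumes "rpoly_deg q \<le> 2 * k" "rpoly_eval x q \<ge> 0"
  shows "loc_psd k q (point_moments k x)"
  unfolding loc_psd_def psd_on_def
proof (intro conjI ballI allI)
  let ?I = "loc_index k q" and ?L = "localizing_matrix k q (point_moments k x)"
  note L = localizing_matrix_point_moments[OF assms(1)]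
  show "?L a b = ?L b a" if "a \<in> ?I" "b \<in> ?I" for a b
    using that by (simp add: L)
  fix v
  have "(\<Sum>a\<in>?I. \<Sum>b\<in>?I. v a * ?L a b * v b) = rpoly_eval x q * (\<Sum>a\<in>?I. v a * monom_eval x a)\<^sup>2"
    by (simp add: L power2_eq_square sum_product sum_distrib_left mult_ac)
  then show "0 \<le> (\<Sum>a\<in>?I. \<Sum>b\<in>?I. v a * ?L a b * v b)" using assms(2) by simp
qed

lemma point_moments_feasible:
  assumes "m \<ge> 2" "k \<ge> k0 m"
    and h: "\<And>i. rpoly_eval x (h_poly m A i) = 0" and f: "rpoly_eval x (f_poly m A) \<ge> c"
  shows "point_moments k x \<in> P_feasible m A c k"
proof -
  have k: "m0 m + m - 1 \<le> 2 * k" using two_k0_ge[of m] assms(2) by linarith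
  then have "m0 m \<le> 2 * k" using assms(1) by linarith
  then have "rpoly_deg (f_poly m A - pConst c) \<le> 2 * k"
    using rpoly_deg_f_poly[OF assms(1), of A] by (intro rpoly_deg_diff_le) auto
  moreover have "rpoly_deg (h_poly m A i) \<le> 2 * k" for i
    using rpoly_deg_h_poly[OF assms(1), of A i] k by linarith
  moreover have "pairing 1 (point_moments k x) = 1"
    by (simp add: pairing_def point_moments_def expos_upto_def)
  moreover have "point_moments k x \<in> extensional (expos_upto (2 * k))"
    by (simp add: point_moments_def)
  ultimately show ?thesis
    using h f by (simp add: P_feasible_def loc_zero_point_moments loc_psd_point_moments rpoly_eval_diff)
qed

section \<open>Normalized eigenvectors as feasible points\<close>

text \<open>Both sides of the eigenvalue equation are homogeneous of degree \<open>m - 1\<close>, so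
  eigenvectors may be rescaled.\<close>

lemma tensor_apply_scale: "tensor_apply m A (\<lambda>i. c * x i) j = c ^ (m - 1) * tensor_apply m A x j"
proof -
  have "(\<Prod>i\<leftarrow>is. c * x i) = c ^ length is * (\<Prod>i\<leftarrow>is. x i)" for "is"
    by (induction "is") (simp_all add: mult_ac)
  then show ?thesis by (simp add: tensor_apply_def sum_distrib_left mult_ac)
qed

lemma H_eigenvalue_normalized:
  assumes "m \<ge> 2" "l \<in> H_eigenvalues m A"
  obtains x where "\<And>j. tensor_apply m A x j = l * x j ^ (m - 1)" "(\<Sum>j\<in>UNIV. x j ^ m0 m) = 1"
proof -
  obtain u where u: "u \<noteq> 0" "\<And>j. tensor_apply m A (($) u) j = l * (u $ j) ^ (m - 1)"
    using assms(2)
    by (auto simp: H_eigenvalues_def H_eigenpair_def Finite_Cartesian_Product.vec_eq_iff)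
  define s where "s = (\<Sum>j\<in>UNIV. (u $ j) ^ m0 m)"
  \<comment> \<open>The factor is chosen so that \<open>c ^ m0 m * s = 1\<close>; this is possible
    because \<open>m0 m\<close> is even, which makes \<open>s\<close> positive.\<close>
  define c where "c = root (m0 m) (1 / s)"
  have even: "even (m0 m)" and pos: "m0 m > 0" using assms(1) by (simp_all add: m0_eq)
  obtain i where i: "u $ i \<noteq> 0"
    using u(1) by (metis Finite_Cartesian_Product.vec_eq_iff zero_index)
  have "s > 0"
    unfolding s_def using even i
    by (intro sum_pos2[of UNIV i]) (auto simp: zero_less_power_eq)
  then have c: "c ^ m0 m = 1 / s"
    unfolding c_def using pos by (intro real_root_pow_pos2) auto
  show ?thesis
  proof
    show "tensor_apply m A (\<lambda>i. c * u $ i) j = l * (c * u $ j) ^ (m - 1)" for j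
      by (simp add: tensor_apply_scale u(2) power_mult_distrib)
    show "(\<Sum>j\<in>UNIV. (c * u $ j) ^ m0 m) = 1"
      using \<open>s > 0\<close> by (simp add: power_mult_distrib c flip: sum_distrib_left sum_divide_distrib s_def)
  qed
qed

lemma P_feasible_nonempty:
  assumes "m \<ge> 2" "k \<ge> k0 m" "l \<in> H_eigenvalues m A" "c \<le> l"
  shows "P_feasible m A c k \<noteq> {}"
proof -
  obtain x where x: "\<And>j. tensor_apply m A x j = l * x j ^ (m - 1)" "(\<Sum>j\<in>UNIV. x j ^ m0 m) = 1"
    using H_eigenvalue_normalized[OF assms(1,3)] by blast
  \<comment> \<open>This splits \<open>x j ^ m0 m\<close> into the factor written in
    \<open>f_poly\<close> and the power in the eigenvalue equation, so \<open>f\<close> takes the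
    value \<open>l\<close> at the normalized \<open>x\<close>.\<close>
  have m: "m0 m = (m0 m + 1 - m) + (m - 1)" using assms(1) m0_eq[of m] by linarith
  have "rpoly_eval x (f_poly m A) = (\<Sum>j\<in>UNIV. l * x j ^ m0 m)"
    by (subst m)
      (simp add: f_poly_def rpoly_eval_sum rpoly_eval_mult rpoly_eval_power rpoly_eval_A_poly x
        power_add mult_ac)
  then have f: "rpoly_eval x (f_poly m A) = l" by (simp add: x flip: sum_distrib_left)
  have "rpoly_eval x (h_poly m A i) = 0" for i
    by (cases i) (simp_all add: rpoly_eval_diff rpoly_eval_sum rpoly_eval_mult rpoly_eval_power
        rpoly_eval_A_poly f x)
  then show ?thesis using point_moments_feasible[OF assms(1,2)] f assms(4) by blast
qed

theorem theorem4p4: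
  fixes A :: "('n::finite, real) tensor" and m :: nat and \<delta> \<mu> :: real
  assumes "m \<ge> 2" and "\<delta> > 0" and "\<mu> \<in> H_eigenvalues m A"
  shows "(upsilon m A \<delta> \<mu> = \<mu> \<and> mu_max m A > \<mu> \<longrightarrow>
            {\<nu> \<in> H_eigenvalues m A. \<nu> \<ge> \<mu> + \<delta>} \<noteq> {} \<and>
            varpi m A (\<mu> + \<delta>) = mu_next m A \<mu>)
       \<and> (upsilon m A \<delta> \<mu> = \<mu> \<and> (\<exists>k\<ge>k0 m. P_feasible m A (\<mu> + \<delta>) k = {}) \<longrightarrow>
            \<mu> = mu_max m A)"
proof -
  let ?H = "H_eigenvalues m A"
  have fin: "finite ?H" by (rule finite_H_eigenvalues[OF assms(1)])
  have max: "mu_max m A \<in> ?H" "\<mu> \<le> mu_max m A"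
    unfolding mu_max_def using fin assms(3) by (auto intro: Max_in Max_ge)
  have gap: "{\<nu> \<in> ?H. \<nu> \<ge> \<mu> + \<delta>} = {\<nu> \<in> ?H. \<nu> > \<mu>}" if "upsilon m A \<delta> \<mu> = \<mu>"
  proof -
    \<comment> \<open>Finiteness makes \<open>Max\<close> a genuine upper bound, so no eigenvalue
      lies strictly above \<mu> and at most \<mu> + \<delta>.\<close>
    have "\<nu> \<le> \<mu>" if "\<nu> \<in> ?H" "\<nu> \<le> \<mu> + \<delta>" for \<nu>
      using \<open>upsilon m A \<delta> \<mu> = \<mu>\<close> Max_ge[of "{\<nu> \<in> ?H. \<nu> \<le> \<mu> + \<delta>}" \<nu>] fin that
      by (simp add: upsilon_def)
    then show ?thesis using assms(2) by force
  qed
  show ?thesis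
  proof (intro conjI impI; elim conjE exE)
    assume u: "upsilon m A \<delta> \<mu> = \<mu>"
    assume "\<mu> < mu_max m A"
    \<comment> \<open>The largest eigenvalue is a member, so the minimum in \<open>varpi\<close> is
      over a nonempty set.\<close>
    then show "{\<nu> \<in> ?H. \<nu> \<ge> \<mu> + \<delta>} \<noteq> {}" using max gap[OF u] by blast
    show "varpi m A (\<mu> + \<delta>) = mu_next m A \<mu>"
      by (simp add: varpi_def mu_next_def gap[OF u])
  next
    fix k assume u: "upsilon m A \<delta> \<mu> = \<mu>"
      and k: "k \<ge> k0 m" "P_feasible m A (\<mu> + \<delta>) k = {}"
    have "\<not> \<mu> < mu_max m A"
    proof
      assume "\<mu> < mu_max m A"
      then have "\<mu> + \<delta> \<le> mu_max m A" using max gap[OF u] by blast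
      then show False using P_feasible_nonempty[OF assms(1) k(1) max(1)] k(2) by blast
    qed
    then show "\<mu> = mu_max m A" using max by simp
  qed
qed

end
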